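(* Let $m\geq 4$ be an even integer and let $r\geq 1$ be an integer. Then $\chi_{la}(rK_{m,m})=3$.
   Context: All graphs are simple and finite. Let $G=(V,E)$ be a graph without isolated vertices. For a bijection $f:E\to\{1,2,\dots,|E|\}$ and a vertex $u$, the weight of $u$ is $w(u)=\sum_{e\in E(u)}f(e)$, where $E(u)$ is the set of edges incident to $u$. The bijection $f$ is a local antimagic labeling of $G$ if $w(u)\neq w(v)$ for every edge $uv\in E$; it then induces a proper vertex coloring of $G$ in which $v$ gets color $w(v)$. The local antimagic chromatic number $\chi_{la}(G)$ is the minimum number of distinct colors (distinct values of $w$) over all local antimagic labelings of $G$. $K_{m,m}$ is the complete bipartite graph with both parts of size $m$, and $rK_{m,m}$ is the disjoint union of $r$ copies of $K_{m,m}$ (the labels $1,\dots,rm^2$ being used across the whole graph). *)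

theory Defs
  imports Complex_Main
begin

type_synonym 'a graph = "'a set \<times> 'a set set"

abbreviation verts :: "'a graph \<Rightarrow> 'a set" where
  "verts G \<equiv> fst G"

abbreviation edges :: "'a graph \<Rightarrow> 'a set set" where
  "edges G \<equiv> snd G"

definition simple_graph :: "'a graph \<Rightarrow> bool" where
  "simple_graph G \<longleftrightarrow> finite (verts G) \<and> (\<forall>e\<in>edges G. e \<subseteq> verts G \<and> card e = 2)"

definition incident_edges :: "'a graph \<Rightarrow> 'a \<Rightarrow> 'a set set" where
  "incident_edges G u = {e \<in> edges G. u \<in> e}"

definition no_isolated_vertices :: "'a graph \<Rightarrow> bool" where
  "no_isolated_vertices G \<longleftrightarrow> (\<forall>u\<in>verts G. incident_edges G u \<noteq> {})"

definition weight :: "'a graph \<Rightarrow> ('a set \<Rightarrow> nat) \<Rightarrow> 'a \<Rightarrow> nat" where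
  "weight G f u = (\<Sum>e\<in>incident_edges G u. f e)"

definition local_antimagic_labeling :: "'a graph \<Rightarrow> ('a set \<Rightarrow> nat) \<Rightarrow> bool" where
  "local_antimagic_labeling G f \<longleftrightarrow>
     bij_betw f (edges G) {1..card (edges G)} \<and>
     (\<forall>u v. {u, v} \<in> edges G \<longrightarrow> weight G f u \<noteq> weight G f v)"

text \<open>The infimum of a nonempty set of naturals is its minimum. On \<^typ>\<open>nat\<close> the infimum of the
  empty set is 0, so a graph with no local antimagic labeling gets the value 0; a positive value
  is therefore always attained by some labeling.\<close>

definition local_antimagic_chromatic_number :: "'a graph \<Rightarrow> nat"  (\<open>\<chi>\<^sub>l\<^sub>a\<close>) where
  "\<chi>\<^sub>l\<^sub>a G = Inf {card (weight G f ` verts G) | f. local_antimagic_labeling G f}"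

definition complete_bipartite :: "nat \<Rightarrow> nat \<Rightarrow> (nat + nat) graph" where
  "complete_bipartite m n =
     ({..<m} <+> {..<n}, {{Inl i, Inr j} | i j. i < m \<and> j < n})"

definition copies :: "nat \<Rightarrow> 'a graph \<Rightarrow> (nat \<times> 'a) graph" where
  "copies r G = ({..<r} \<times> verts G, {Pair k ` e | k e. k < r \<and> e \<in> edges G})"

lemma simple_graph_complete_bipartite: "simple_graph (complete_bipartite m n)"
  by (auto simp: simple_graph_def complete_bipartite_def)

lemma no_isolated_vertices_complete_bipartite:
  assumes "m > 0" "n > 0"
  shows "no_isolated_vertices (complete_bipartite m n)"
  unfolding no_isolated_vertices_def
proof
  fix u assume "u \<in> verts (complete_bipartite m n)"
  then consider i where "u = Inl i" "i < m" | j where "u = Inr j" "j < n"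
    by (auto simp: complete_bipartite_def)
  then show "incident_edges (complete_bipartite m n) u \<noteq> {}"
  proof cases
    case 1
    then have "{Inl i, Inr 0} \<in> incident_edges (complete_bipartite m n) u"
      using assms by (auto simp: incident_edges_def complete_bipartite_def)
    then show ?thesis by blast
  next
    case 2
    then have "{Inl 0, Inr j} \<in> incident_edges (complete_bipartite m n) u"
      using assms by (auto simp: incident_edges_def complete_bipartite_def)
    then show ?thesis by blast
  qed
qed

lemma simple_graph_copies:
  assumes "simple_graph G"
  shows "simple_graph (copies r G)"
proof -
  have "card (Pair k ` e) = card e" for k :: nat and e :: "'a set"
    by (rule card_image) (simp add: inj_on_def)
  then show ?thesis
    using assms unfolding simple_graph_def copies_def by auto
qed

lemma no_isolated_vertices_copies:
  assumes "no_isolated_vertices G"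
  shows "no_isolated_vertices (copies r G)"
  unfolding no_isolated_vertices_def
proof
  fix u assume "u \<in> verts (copies r G)"
  then obtain k v where u: "u = (k, v)" "k < r" "v \<in> verts G"
    by (auto simp: copies_def)
  then obtain e where "e \<in> edges G" "v \<in> e"
    using assms by (auto simp: no_isolated_vertices_def incident_edges_def)
  then have "Pair k ` e \<in> incident_edges (copies r G) u"
    using u by (auto simp: incident_edges_def copies_def)
  then show "incident_edges (copies r G) u \<noteq> {}" by blast
qed

end

theory Submission
  imports Defs
begin

text \<open>A local antimagic labeling is a filling of \<open>r\<close> square matrices of order \<open>m\<close> by the numbers
  \<open>1, \<dots>, N\<close> with \<open>N = r m\<^sup>2\<close>; the weights are the row and column sums.
  With two colors, each matrix would have constant row sums and constant column sums, and double
  counting would make these equal; so three colors are necessary.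
  For three colors, put complementary labels \<open>t + 1\<close> and \<open>N - t\<close> next to each other in columns
  \<open>2l\<close> and \<open>2l + 1\<close> of a row, so that every row sum is \<open>(m/2) (N + 1)\<close>. Let \<open>t\<close> run through
  consecutive values down the column pair, swapping the two labels in every other row: two
  vertically adjacent entries then sum to \<open>N\<close> in an even column and to \<open>N + 2\<close> in an odd one.\<close>

section \<open>Edges and weights, addressed by copy, row and column\<close>

definition edge :: "nat \<Rightarrow> nat \<Rightarrow> nat \<Rightarrow> (nat \<times> (nat + nat)) set" where
  "edge k i j = {(k, Inl i), (k, Inr j)}"

lemma edge_eq_iff [simp]: "edge k i j = edge k' i' j' \<longleftrightarrow> k = k' \<and> i = i' \<and> j = j'"
  by (auto simp: edge_def doubleton_eq_iff)

lemma edges_copies_complete_bipartite: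
  "edges (copies r (complete_bipartite m n)) =
     (\<lambda>(k, i, j). edge k i j) ` ({..<r} \<times> {..<m} \<times> {..<n})"
  by (auto simp: copies_def complete_bipartite_def edge_def image_iff) (metis image_empty image_insert)

lemma edge_mem_copies_iff:
  "edge k i j \<in> edges (copies r (complete_bipartite m n)) \<longleftrightarrow> k < r \<and> i < m \<and> j < n"
  by (auto simp: edges_copies_complete_bipartite)

lemma inj_on_edge: "inj_on (\<lambda>(k, i, j). edge k i j) A"
  by (auto simp: inj_on_def)

lemma card_edges_copies_complete_bipartite:
  "card (edges (copies r (complete_bipartite m n))) = r * (m * n)"
  by (simp add: edges_copies_complete_bipartite card_image inj_on_edge card_cartesian_product)

lemma weight_copies_Inl:
  assumes "k < r" "i < m"
  shows "weight (copies r (complete_bipartite m n)) f (k, Inl i) = (\<Sum>j<n. f (edge k i j))"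
proof -
  have "incident_edges (copies r (complete_bipartite m n)) (k, Inl i) = edge k i ` {..<n}"
    using assms by (auto simp: incident_edges_def edges_copies_complete_bipartite) (auto simp: edge_def)
  then show ?thesis
    by (simp add: weight_def sum.reindex inj_on_def)
qed

lemma weight_copies_Inr:
  assumes "k < r" "j < n"
  shows "weight (copies r (complete_bipartite m n)) f (k, Inr j) = (\<Sum>i<m. f (edge k i j))"
proof -
  have "incident_edges (copies r (complete_bipartite m n)) (k, Inr j) = (\<lambda>i. edge k i j) ` {..<m}"
    using assms by (auto simp: incident_edges_def edges_copies_complete_bipartite) (auto simp: edge_def)
  then show ?thesis
    by (simp add: weight_def sum.reindex inj_on_def)
qed

lemma verts_copies_complete_bipartite:
  "verts (copies r (complete_bipartite m n)) =
     (\<lambda>(k, i). (k, Inl i)) ` ({..<r} \<times> {..<m}) \<union> (\<lambda>(k, j). (k, Inr j)) ` ({..<r} \<times> {..<n})"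
  by (auto simp: copies_def complete_bipartite_def)

section \<open>Lower bound\<close>

lemma three_le_card_weights:
  assumes f: "local_antimagic_labeling (copies r (complete_bipartite m m)) f"
    and "r > 0" "m > 0"
  shows "3 \<le> card (weight (copies r (complete_bipartite m m)) f ` verts (copies r (complete_bipartite m m)))"
    (is "3 \<le> card ?W")
proof (rule ccontr)
  let ?w = "weight (copies r (complete_bipartite m m)) f"
  \<comment> \<open>Copy 0 alone already forces three colors; it exists because r > 0.\<close>
  have diff: "?w (0, Inl i) \<noteq> ?w (0, Inr j)" if "i < m" "j < m" for i j
    using f that \<open>r > 0\<close> edge_mem_copies_iff[of 0 i j r m m]
    by (auto simp: local_antimagic_labeling_def edge_def)
  have left: "?w (0, Inl i) \<in> ?W" and right: "?w (0, Inr i) \<in> ?W" if "i < m" for i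
    using that \<open>r > 0\<close> by (auto simp: verts_copies_complete_bipartite)
  have "finite ?W"
    by (simp add: verts_copies_complete_bipartite)
  define a b where "a = ?w (0, Inl 0)" and "b = ?w (0, Inr 0)"
  have "a \<noteq> b" "a \<in> ?W" "b \<in> ?W"
    using diff left right \<open>m > 0\<close> by (simp_all add: a_def b_def)
  assume "\<not> 3 \<le> card ?W"
  then have "card ?W \<le> card {a, b}"
    using \<open>a \<noteq> b\<close> by simp
  then have W: "?W = {a, b}"
    using \<open>finite ?W\<close> \<open>a \<in> ?W\<close> \<open>b \<in> ?W\<close> by (intro card_seteq[symmetric]) auto
  \<comment> \<open>Each row vertex is adjacent to column vertex 0, whose color is b, so only a is
    left for it; symmetrically for the columns.\<close>
  have rows: "?w (0, Inl i) = a" if "i < m" for i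
    using left[OF that] diff[OF that \<open>m > 0\<close>] by (simp add: W b_def)
  have cols: "?w (0, Inr j) = b" if "j < m" for j
    using right[OF that] diff[OF \<open>m > 0\<close> that] by (simp add: W a_def)
  have "m * a = (\<Sum>i<m. ?w (0, Inl i))"
    using rows by simp
  also have "\<dots> = (\<Sum>i<m. \<Sum>j<m. f (edge 0 i j))"
    using \<open>r > 0\<close> by (simp add: weight_copies_Inl)
  also have "\<dots> = (\<Sum>j<m. \<Sum>i<m. f (edge 0 i j))"
    by (rule sum.swap)
  also have "\<dots> = (\<Sum>j<m. ?w (0, Inr j))"
    using \<open>r > 0\<close> by (simp add: weight_copies_Inr)
  also have "\<dots> = m * b"
    using cols by simp
  finally show False
    using \<open>a \<noteq> b\<close> \<open>m > 0\<close> by simp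
qed

section \<open>The labeling with three colors\<close>

text \<open>The value t for matrices of order 2n: column pairs are numbered consecutively across all
  copies, and each pair uses a block of 2n values, one per row.\<close>

definition cell :: "nat \<Rightarrow> nat \<Rightarrow> nat \<Rightarrow> nat \<Rightarrow> nat" where
  "cell n k i j = (k * n + j div 2) * (2 * n) + i"

definition entry :: "nat \<Rightarrow> nat \<Rightarrow> nat \<Rightarrow> nat \<Rightarrow> nat \<Rightarrow> nat" where
  "entry N n k i j = (if even (i + j) then cell n k i j + 1 else N - cell n k i j)"

lemma mult_add_less_mult:
  fixes a b c d :: nat
  assumes "a < c" "b < d"
  shows "a * d + b < c * d"
proof -
  have "a * d + b < Suc a * d"
    using assms by simp
  also have "\<dots> \<le> c * d"
    using assms by (intro mult_le_mono1) simp
  finally show ?thesis .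
qed

lemma mult_add_inject:
  fixes a b c d :: nat
  assumes "a * d + b = c * d + e" "b < d" "e < d"
  shows "a = c \<and> b = e"
proof -
  have "a = (a * d + b) div d" "b = (a * d + b) mod d" "c = (c * d + e) div d" "e = (c * d + e) mod d"
    using assms(2,3) by simp_all
  then show ?thesis
    using assms(1) by metis
qed

text \<open>There are N/2 values of t. Hence t + 1 stays in the lower half of the labels and N - t
  in the upper half, and the subtraction never truncates.\<close>

lemma cell_less:
  assumes "N = r * (2 * n * (2 * n))" "k < r" "i < 2 * n" "j < 2 * n"
  shows "2 * (cell n k i j + 1) \<le> N"
proof -
  have "cell n k i j < r * n * (2 * n)"
    unfolding cell_def using assms by (intro mult_add_less_mult) auto
  then show ?thesis
    using assms(1) by (simp add: algebra_simps)
qed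

text \<open>Digits are read off twice, in base 2n and then in base n. The two columns of a pair
  share t, so j is recovered only up to its pair.\<close>

lemma cell_inject:
  assumes "cell n k i j = cell n k' i' j'"
    and "i < 2 * n" "j < 2 * n" "i' < 2 * n" "j' < 2 * n"
  shows "k = k' \<and> i = i' \<and> j div 2 = j' div 2"
proof -
  have "k * n + j div 2 = k' * n + j' div 2 \<and> i = i'"
    using assms unfolding cell_def by (intro mult_add_inject) auto
  moreover from this have "k = k' \<and> j div 2 = j' div 2"
    using assms by (intro mult_add_inject[of _ n]) auto
  ultimately show ?thesis by simp
qed

lemma bij_betw_entry:
  assumes N: "N = r * (2 * n * (2 * n))"
  shows "bij_betw (\<lambda>(k, i, j). entry N n k i j) ({..<r} \<times> {..<2 * n} \<times> {..<2 * n}) {1..N}"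
    (is "bij_betw ?h ?A ?B")
proof -
  have "k = k' \<and> i = i' \<and> j = j'"
    if less: "k < r" "i < 2 * n" "j < 2 * n" "k' < r" "i' < 2 * n" "j' < 2 * n"
      and eq: "entry N n k i j = entry N n k' i' j'" for k i j k' i' j'
  proof -
    note bounds = cell_less[OF N less(1-3)] cell_less[OF N less(4-6)]
    \<comment> \<open>The half in which a label lies reveals the branch of \<open>entry\<close>;
      with the row known, this gives the parity of j that \<open>cell\<close> forgets.\<close>
    have "cell n k i j = cell n k' i' j' \<and> (even (i + j) \<longleftrightarrow> even (i' + j'))"
      using eq bounds unfolding entry_def
      by (cases "even (i + j)"; cases "even (i' + j')"; simp only: if_True if_False; simp)
    then have *: "k = k'" "i = i'" "j div 2 = j' div 2" "even j \<longleftrightarrow> even j'"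
      using cell_inject[OF _ less(2,3,5,6)] by auto
    from *(3,4) have "j = j'" by presburger
    with * show ?thesis by simp
  qed
  then have inj: "inj_on ?h ?A"
    by (auto simp: inj_on_def)
  have "entry N n k i j \<in> ?B" if "k < r" "i < 2 * n" "j < 2 * n" for k i j
    using cell_less[OF N that] unfolding entry_def by auto
  then have "?h ` ?A \<subseteq> ?B" by auto
  moreover have "card (?h ` ?A) = card ?B"
    using inj by (simp add: N card_image card_cartesian_product)
  ultimately have "?h ` ?A = ?B"
    by (intro card_subset_eq) auto
  with inj show ?thesis
    by (simp add: bij_betw_def)
qed

lemma sum_lessThan_double:
  "(\<Sum>i<2 * n. g i) = (\<Sum>l<n. g (2 * l) + g (2 * l + 1))" for g :: "nat \<Rightarrow> nat"
  by (induction n) simp_all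

lemma row_sum_entry:
  assumes "N = r * (2 * n * (2 * n))" "k < r" "i < 2 * n"
  shows "(\<Sum>j<2 * n. entry N n k i j) = n * (N + 1)"
proof -
  have "entry N n k i (2 * l) + entry N n k i (2 * l + 1) = N + 1" if "l < n" for l
  proof -
    have "cell n k i (2 * l + 1) = cell n k i (2 * l)"
      by (simp add: cell_def)
    then show ?thesis
      using cell_less[OF assms, of "2 * l"] that unfolding entry_def by simp
  qed
  then show ?thesis
    unfolding sum_lessThan_double by simp
qed

lemma column_sum_entry:
  assumes "N = r * (2 * n * (2 * n))" "k < r" "j < 2 * n"
  shows "(\<Sum>i<2 * n. entry N n k i j) = n * (N + (if even j then 0 else 2))"
proof -
  have "entry N n k (2 * l) j + entry N n k (2 * l + 1) j = N + (if even j then 0 else 2)"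
    if "l < n" for l
  proof -
    \<comment> \<open>With t taken in row 2l, an even column contributes (t + 1) + (N - (t + 1)) and
      an odd one (N - t) + (t + 2).\<close>
    have "cell n k (2 * l + 1) j = cell n k (2 * l) j + 1"
      by (simp add: cell_def)
    then show ?thesis
      using cell_less[OF assms(1,2) _ assms(3), of "2 * l + 1"] that unfolding entry_def by simp
  qed
  then show ?thesis
    unfolding sum_lessThan_double by simp
qed

lemma ex_three_weights:
  fixes n r :: nat
  assumes "n > 0"
  defines "G \<equiv> copies r (complete_bipartite (2 * n) (2 * n))"
  obtains f where "local_antimagic_labeling G f" "card (weight G f ` verts G) \<le> 3"
proof -
  let ?A = "{..<r} \<times> {..<2 * n} \<times> {..<2 * n}"
  define N where N: "N = r * (2 * n * (2 * n))"
  \<comment> \<open>Labels live on edges as sets, so the matrix entries are transported along the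
    inverse of the parametrization by triples.\<close>
  define f where "f = (\<lambda>(k, i, j). entry N n k i j) \<circ> the_inv_into ?A (\<lambda>(k, i, j). edge k i j)"
  have f: "f (edge k i j) = entry N n k i j" if "k < r" "i < 2 * n" "j < 2 * n" for k i j
    using the_inv_into_f_f[OF inj_on_edge, of "(k, i, j)" ?A] that by (simp add: f_def)
  have bij: "bij_betw f (edges G) {1..card (edges G)}"
    unfolding G_def card_edges_copies_complete_bipartite N[symmetric]
    unfolding f_def edges_copies_complete_bipartite
    by (intro bij_betw_trans[OF bij_betw_the_inv_into bij_betw_entry[OF N]] inj_on_imp_bij_betw inj_on_edge)
  have rows: "weight G f (k, Inl i) = n * (N + 1)" if "k < r" "i < 2 * n" for k i
    using that row_sum_entry[OF N that] by (simp add: G_def weight_copies_Inl f)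
  have cols: "weight G f (k, Inr j) = n * (N + (if even j then 0 else 2))"
    if "k < r" "j < 2 * n" for k j
    using that column_sum_entry[OF N that] by (simp add: G_def weight_copies_Inr f)
  have neq: "weight G f (k, Inl i) \<noteq> weight G f (k, Inr j)"
    if "k < r" "i < 2 * n" "j < 2 * n" for k i j
    \<comment> \<open>Cancelling n leaves N + 1 against N or N + 2.\<close>
    using that \<open>n > 0\<close> by (simp only: rows cols mult_cancel1) auto
  have "weight G f u \<noteq> weight G f v" if uv: "{u, v} \<in> edges G" for u v
  proof -
    obtain k i j where "k < r" "i < 2 * n" "j < 2 * n" "{u, v} = edge k i j"
      using uv unfolding G_def edges_copies_complete_bipartite by auto
    then show ?thesis
      using neq[of k i j] by (auto simp: edge_def doubleton_eq_iff)
  qed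
  with bij have "local_antimagic_labeling G f"
    by (simp add: local_antimagic_labeling_def)
  moreover have "card (weight G f ` verts G) \<le> 3"
  proof -
    have "weight G f ` verts G \<subseteq> {n * (N + 1), n * (N + 0), n * (N + 2)}"
      unfolding G_def verts_copies_complete_bipartite
      using rows cols by (auto simp: G_def simp del: mult_Suc_right add_Suc_right split: if_splits)
    then have "card (weight G f ` verts G) \<le> card {n * (N + 1), n * (N + 0), n * (N + 2)}"
      by (intro card_mono) auto
    also have "\<dots> \<le> 3"
      using card_length[of "[n * (N + 1), n * (N + 0), n * (N + 2)]"] by simp
    finally show ?thesis .
  qed
  ultimately show thesis
    by (rule that)
qed

theorem theorem2p3:
  fixes m r :: nat
  assumes "m \<ge> 4" and "even m" and "r \<ge> 1"
  shows "\<chi>\<^sub>l\<^sub>a (copies r (complete_bipartite m m)) = 3"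
proof -
  let ?G = "copies r (complete_bipartite m m)"
  have lower: "3 \<le> card (weight ?G f ` verts ?G)" if "local_antimagic_labeling ?G f" for f
    using that assms by (intro three_le_card_weights) auto
  obtain n where "m = 2 * n" "n > 0"
    using assms by (auto elim: evenE)
  then obtain f where "local_antimagic_labeling ?G f" "card (weight ?G f ` verts ?G) \<le> 3"
    using ex_three_weights by blast
  moreover from this have "card (weight ?G f ` verts ?G) = 3"
    using lower by (simp add: le_antisym)
  \<comment> \<open>A labeling attaining 3 makes the set of color counts nonempty, so its infimum is
    a true minimum and not the default 0.\<close>
  ultimately show ?thesis
    unfolding local_antimagic_chromatic_number_def
    by (intro cInf_eq_minimum) (force, use lower in auto)
qed

end
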